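(* Let $\mu$ be a mass distribution on $\mathbb{R}^d$ with bounded support, and let $p\in[1,\infty)\cup\{\infty\}$. There exists $c\in\mathbb{R}^d$ such that $\mu(\mathcal{H}^p_{c,v})\ge\frac{1}{d+1}\mu(\mathbb{R}^d)$ for all $v\in S^{d-1}$.
   Context: A mass distribution is a measure $\mu$ on $\mathbb{R}^d$ that is absolutely continuous with respect to Lebesgue measure and satisfies $\mu(\mathbb{R}^d)<\infty$. For $x\in\mathbb{R}^d$ and $v\in\mathbb{R}^d\setminus\{0\}$, the (limit) $\ell_p$-halfspace is $\mathcal{H}^p_{x,v}=\{z\in\mathbb{R}^d : \|x-z\|_p\le\|x-\epsilon v-z\|_p \text{ for all }\epsilon>0\}$, where $\|\cdot\|_p$ is the $\ell_p$-norm ($\|y\|_\infty=\max_i|y_i|$). $S^{d-1}$ is the Euclidean unit sphere. *)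

theory Defs
  imports "HOL-Analysis.Analysis"
begin

definition lp_norm :: "ereal \<Rightarrow> real ^ 'n \<Rightarrow> real" where
  "lp_norm p x =
     (if p = \<infinity> then infnorm x
      else (\<Sum>i\<in>UNIV. \<bar>x $ i\<bar> powr real_of_ereal p) powr (1 / real_of_ereal p))"

definition lp_halfspace :: "ereal \<Rightarrow> real ^ 'n \<Rightarrow> real ^ 'n \<Rightarrow> (real ^ 'n) set" where
  "lp_halfspace p x v =
     {z. \<forall>\<epsilon>>0. lp_norm p (x - z) \<le> lp_norm p (x - \<epsilon> *\<^sub>R v - z)}"

(* Borel measures: a finite measure that is absolutely continuous with respect to Lebesgue
   measure extends uniquely from the Borel to the Lebesgue sigma-algebra. *)
definition mass_distribution :: "(real ^ 'n) measure \<Rightarrow> bool" where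
  "mass_distribution \<mu> \<longleftrightarrow>
     sets \<mu> = sets borel \<and> absolutely_continuous lborel \<mu> \<and> emeasure \<mu> UNIV < \<infinity>"

definition measure_support :: "'a::topological_space measure \<Rightarrow> 'a set" where
  "measure_support \<mu> = {x. \<forall>U. open U \<and> x \<in> U \<longrightarrow> emeasure \<mu> U > 0}"

lemma continuous_on_lp_norm:
  fixes f :: "'a::topological_space \<Rightarrow> real ^ 'n"
  assumes "1 \<le> p" and f: "continuous_on S f"
  shows "continuous_on S (\<lambda>x. lp_norm p (f x))"
proof (cases p)
  case (real r)
  then have "r \<ge> 1" using assms(1) by simp
  then show ?thesis
    unfolding lp_norm_def using real
    by (auto intro!: continuous_intros continuous_on_powr' f sum_nonneg)
next
  case PInf
  then show ?thesis
    unfolding lp_norm_def continuous_on_def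
    using f by (auto simp: continuous_on_def intro: tendsto_infnorm)
qed (use assms(1) in auto)

(* In particular halfspaces are Borel, so their measure is not the default value 0. *)
lemma closed_lp_halfspace:
  assumes "1 \<le> p"
  shows "closed (lp_halfspace p x v)"
proof -
  have "lp_halfspace p x v =
      (\<Inter>\<epsilon>\<in>{0<..}. {z. lp_norm p (x - z) \<le> lp_norm p (x - \<epsilon> *\<^sub>R v - z)})"
    by (auto simp: lp_halfspace_def)
  also have "closed \<dots>"
    by (intro closed_INT ballI closed_Collect_le continuous_on_lp_norm assms continuous_intros)
  finally show ?thesis .
qed

end

theory Submission
  imports Defs
begin

text \<open>
  The argument works for the sets where a convex coercive function f does not decrease, and
  the p-norm enters only through such an f (the sum of the p-th powers of the coordinates).
  Suppose that every c has a bad direction v, one for which the halfspace has mass less than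
  a fraction 1 / (d + 1) of the total. Badness of v is an open condition on c, so a partition of
  unity on a large ball yields a continuous field W(c) in the cone spanned by the bad directions.
  By Caratheodory's theorem W(c) is a combination of at most d + 1 bad directions; their halfspaces
  do not exhaust the mass, so some z in the support lies in none of them, and by convexity
  f decreases from c - z in direction - W(c). In particular W(c) is nonzero. A Brouwer fixed point
  of c - W(c) projected to the ball is then a boundary point c at which - W(c) points radially
  outwards, so that f (c - z) < f (- z), which contradicts coercivity.
\<close>

section \<open>Descent directions of a convex function\<close>

text \<open>The step goes along \<open>- v\<close>, the sign convention of the halfspaces. With it,
  a point \<open>z\<close> misses the halfspace at \<open>c\<close> exactly if \<open>v\<close> is
  such a direction at \<open>c - z\<close>.\<close>

definition descent_directions :: "('a::real_vector \<Rightarrow> real) \<Rightarrow> 'a \<Rightarrow> 'a set" where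
  "descent_directions f a = {v. \<exists>\<epsilon>>0. f (a - \<epsilon> *\<^sub>R v) < f a}"

lemma zero_notin_descent_directions: "0 \<notin> descent_directions f a"
  by (simp add: descent_directions_def)

lemma descent_directions_scaleR:
  assumes "v \<in> descent_directions f a" "0 < s"
  shows "s *\<^sub>R v \<in> descent_directions f a"
proof -
  obtain e where "e > 0" "f (a - e *\<^sub>R v) < f a"
    using assms by (auto simp: descent_directions_def)
  then have "e / s > 0" "f (a - (e / s) *\<^sub>R s *\<^sub>R v) < f a"
    using assms by auto
  then show ?thesis
    unfolding descent_directions_def by blast
qed

text \<open>The shorter step ends on the segment from \<open>a\<close> to the end of the longer one,
  where convexity keeps \<open>f\<close> below \<open>f a\<close>. This allows a common step length
  for several directions.\<close>

lemma descent_step_shrink: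
  assumes f: "convex_on UNIV f" and "f (a - e *\<^sub>R v) < f a" "0 < d" "d \<le> e"
  shows "f (a - d *\<^sub>R v) < f a"
proof -
  define t where "t = d / e"
  have t: "0 < t" "t \<le> 1" using assms by (auto simp: t_def)
  have "a - d *\<^sub>R v = (1 - t) *\<^sub>R a + t *\<^sub>R (a - e *\<^sub>R v)"
    using assms by (simp add: t_def algebra_simps)
  then have "f (a - d *\<^sub>R v) \<le> (1 - t) * f a + t * f (a - e *\<^sub>R v)"
    using convex_onD[OF f, of t a "a - e *\<^sub>R v"] t by simp
  also have "\<dots> < (1 - t) * f a + t * f a"
    using assms t by simp
  finally show ?thesis by (simp add: algebra_simps)
qed

lemma convex_descent_directions:
  assumes f: "convex_on UNIV f"
  shows "convex (descent_directions f a)"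
  unfolding convex_alt
proof (intro ballI allI impI, elim conjE)
  fix v w t
  assume vw: "v \<in> descent_directions f a" "w \<in> descent_directions f a"
    and t: "0 \<le> t" "t \<le> (1::real)"
  then obtain e1 e2 where e: "e1 > 0" "f (a - e1 *\<^sub>R v) < f a" "e2 > 0" "f (a - e2 *\<^sub>R w) < f a"
    by (auto simp: descent_directions_def)
  \<comment> \<open>With a common step length, the step along a convex combination of
    \<open>v\<close> and \<open>w\<close> is the convex combination of their steps.\<close>
  define e where "e = min e1 e2"
  have e0: "e > 0" "f (a - e *\<^sub>R v) < f a" "f (a - e *\<^sub>R w) < f a"
    using e descent_step_shrink[OF f, of a e1 v e] descent_step_shrink[OF f, of a e2 w e]
    by (auto simp: e_def)
  have "a - e *\<^sub>R ((1 - t) *\<^sub>R v + t *\<^sub>R w) = (1 - t) *\<^sub>R (a - e *\<^sub>R v) + t *\<^sub>R (a - e *\<^sub>R w)"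
    by (simp add: algebra_simps)
  then have "f (a - e *\<^sub>R ((1 - t) *\<^sub>R v + t *\<^sub>R w))
      \<le> (1 - t) * f (a - e *\<^sub>R v) + t * f (a - e *\<^sub>R w)"
    using convex_onD[OF f, of t "a - e *\<^sub>R v" "a - e *\<^sub>R w"] t by simp
  also have "\<dots> < f a"
    using t e0(2,3) by (intro convex_bound_lt) auto
  finally show "(1 - t) *\<^sub>R v + t *\<^sub>R w \<in> descent_directions f a"
    using e0(1) unfolding descent_directions_def by blast
qed

text \<open>On the line through \<open>- z\<close> in direction \<open>c\<close>, the value of
  \<open>f\<close> falls when moving from \<open>c - z\<close> away from \<open>- z\<close>. A
  convex function on a line that still falls there must have been larger at
  \<open>- z\<close>.\<close>

lemma descent_directions_radial:
  assumes f: "convex_on UNIV f" and "- (s *\<^sub>R c) \<in> descent_directions f (c - z)" "0 < s"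
  shows "f (c - z) < f (- z)"
proof -
  have "(1 / s) *\<^sub>R (- (s *\<^sub>R c)) \<in> descent_directions f (c - z)"
    using assms by (intro descent_directions_scaleR) auto
  then have "- c \<in> descent_directions f (c - z)"
    using \<open>0 < s\<close> by simp
  then obtain e where e: "e > 0" "f (c - z + e *\<^sub>R c) < f (c - z)"
    by (auto simp: descent_directions_def)
  \<comment> \<open>This weight solves \<open>(1 - t) * (1 + e) = 1\<close>, which places
    \<open>c - z\<close> between \<open>c - z + e *\<^sub>R c\<close> and
    \<open>- z\<close>.\<close>
  define t where "t = e / (1 + e)"
  have t: "0 < t" "t < 1" using e by (auto simp: t_def field_simps)
  have "(1 - t) * (1 + e) = 1"
    using e by (simp add: t_def field_simps)
  moreover have "(1 - t) *\<^sub>R (c - z + e *\<^sub>R c) + t *\<^sub>R (- z) = ((1 - t) * (1 + e)) *\<^sub>R c - z"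
    by (simp add: algebra_simps)
  ultimately have "c - z = (1 - t) *\<^sub>R (c - z + e *\<^sub>R c) + t *\<^sub>R (- z)"
    by simp
  then have "f (c - z) \<le> (1 - t) * f (c - z + e *\<^sub>R c) + t * f (- z)"
    using convex_onD[OF f, of t "c - z + e *\<^sub>R c" "- z"] t by simp
  also have "\<dots> < (1 - t) * f (c - z) + t * f (- z)"
    using e t by simp
  finally have "t * f (c - z) < t * f (- z)" by (simp add: algebra_simps)
  then show ?thesis using t by simp
qed

section \<open>Halfspaces of a convex function\<close>

definition convex_halfspace :: "('a::real_vector \<Rightarrow> real) \<Rightarrow> 'a \<Rightarrow> 'a \<Rightarrow> 'a set" where
  "convex_halfspace f c v = {z. \<forall>\<epsilon>>0. f (c - z) \<le> f (c - \<epsilon> *\<^sub>R v - z)}"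

lemma notin_convex_halfspace:
  "z \<notin> convex_halfspace f c v \<longleftrightarrow> v \<in> descent_directions f (c - z)"
  by (force simp: convex_halfspace_def descent_directions_def algebra_simps not_le)

lemma closed_convex_halfspace:
  fixes f :: "'a::real_normed_vector \<Rightarrow> real"
  assumes "continuous_on UNIV f"
  shows "closed (convex_halfspace f c v)"
proof -
  have "convex_halfspace f c v = (\<Inter>\<epsilon>\<in>{0<..}. {z. f (c - z) \<le> f (c - \<epsilon> *\<^sub>R v - z)})"
    by (auto simp: convex_halfspace_def)
  also have "closed \<dots>"
    by (intro closed_INT ballI closed_Collect_le continuous_on_compose2[OF assms] continuous_intros) auto
  finally show ?thesis .
qed

text \<open>The mass of the halfspace is upper semicontinuous in \<open>c\<close>: for a sequence
  tending to \<open>c\<close>, the limit superior of the halfspaces lies in the halfspace at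
  \<open>c\<close>, and a finite measure is continuous from above.\<close>

lemma open_convex_halfspace_measure_less:
  fixes f :: "'a::real_normed_vector \<Rightarrow> real"
  assumes "finite_measure M" and sets: "sets M = sets borel" and f: "continuous_on UNIV f"
  shows "open {c. measure M (convex_halfspace f c v) < \<tau>}"
proof -
  interpret finite_measure M by fact
  have meas: "convex_halfspace f c v \<in> sets M" for c
    using closed_convex_halfspace[OF f] sets by simp
  have "closed {c. \<tau> \<le> measure M (convex_halfspace f c v)}"
    unfolding closed_sequential_limits
  proof (intro allI impI, elim conjE)
    fix x c
    assume x: "\<forall>n. x n \<in> {c. \<tau> \<le> measure M (convex_halfspace f c v)}" and lim: "x \<longlonglongrightarrow> c"
    \<comment> \<open>The tail unions decrease to the limit superior of the halfspaces.\<close>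
    define A where "A n = (\<Union>k\<in>{n..}. convex_halfspace f (x k) v)" for n
    have A: "A n \<in> sets M" for n
      unfolding A_def using meas by (intro sets.countable_UN') auto
    have "\<tau> \<le> measure M (A n)" for n
    proof -
      have "\<tau> \<le> measure M (convex_halfspace f (x n) v)" using x by auto
      also have "\<dots> \<le> measure M (A n)"
        using A by (intro finite_measure_mono) (auto simp: A_def)
      finally show ?thesis .
    qed
    moreover have "(\<lambda>n. measure M (A n)) \<longlonglongrightarrow> measure M (\<Inter>n. A n)"
      using A by (intro finite_Lim_measure_decseq) (auto simp: decseq_def A_def intro: order_trans)
    ultimately have "\<tau> \<le> measure M (\<Inter>n. A n)"
      by (intro LIMSEQ_le_const) auto
    also have "\<dots> \<le> measure M (convex_halfspace f c v)"
    proof (intro finite_measure_mono meas subsetI)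
      fix z assume z: "z \<in> (\<Inter>n. A n)"
      \<comment> \<open>A strict violation at \<open>c\<close> would persist at \<open>x n\<close>
        for all large \<open>n\<close>, while \<open>z\<close> lies in halfspaces of arbitrarily
        large index.\<close>
      have "f (c - z) \<le> f (c - e *\<^sub>R v - z)" if "e > 0" for e
      proof (rule ccontr)
        assume "\<not> ?thesis"
        moreover have cont: "isCont f y" for y
          using f by (simp add: continuous_on_eq_continuous_at)
        have "(\<lambda>n. f (x n - z)) \<longlonglongrightarrow> f (c - z)" "(\<lambda>n. f (x n - e *\<^sub>R v - z)) \<longlonglongrightarrow> f (c - e *\<^sub>R v - z)"
          by (intro isCont_tendsto_compose[OF cont] tendsto_intros lim)+
        then have "(\<lambda>n. f (x n - z) - f (x n - e *\<^sub>R v - z)) \<longlonglongrightarrow> f (c - z) - f (c - e *\<^sub>R v - z)"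
          by (intro tendsto_diff)
        ultimately have "\<forall>\<^sub>F n in sequentially. 0 < f (x n - z) - f (x n - e *\<^sub>R v - z)"
          by (intro order_tendstoD(1)) auto
        then obtain N where "\<And>n. n \<ge> N \<Longrightarrow> f (x n - e *\<^sub>R v - z) < f (x n - z)"
          by (auto simp: eventually_sequentially)
        moreover obtain k where "k \<ge> N" "z \<in> convex_halfspace f (x k) v"
          using z by (auto simp: A_def)
        ultimately show False
          using that by (force simp: convex_halfspace_def)
      qed
      then show "z \<in> convex_halfspace f c v" by (simp add: convex_halfspace_def)
    qed
    finally show "c \<in> {c. \<tau> \<le> measure M (convex_halfspace f c v)}" by simp
  qed
  moreover have "{c. measure M (convex_halfspace f c v) < \<tau>}
      = - {c. \<tau> \<le> measure M (convex_halfspace f c v)}" by auto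
  ultimately show ?thesis by (simp add: open_closed)
qed

section \<open>Auxiliary facts: covers by small sets, conic combinations, fixed points\<close>

lemma Compl_measure_support_null_set:
  fixes M :: "'a::second_countable_topology measure"
  assumes sets: "sets M = sets borel"
  shows "- measure_support M \<in> null_sets M"
proof -
  define F where "F = {U. open U \<and> emeasure M U = 0}"
  \<comment> \<open>Lindelof reduces the union of all open null sets to a countable one.\<close>
  obtain F' where F': "F' \<subseteq> F" "countable F'" "\<Union>F' = \<Union>F"
    using Lindelof[of F] by (auto simp: F_def)
  have "- measure_support M = \<Union>F"
    by (auto simp: F_def measure_support_def)
  then have "- measure_support M = (\<Union>U\<in>F'. U)"
    using F' by simp
  also have "\<dots> \<in> null_sets M"
    using F' sets by (intro null_sets_UN') (auto simp: F_def null_sets_def)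
  finally show ?thesis .
qed

text \<open>By the union bound, at most \<open>n\<close> sets, each with less than the fraction
  \<open>1 / n\<close> of a positive total mass, cannot cover the space up to a null set.\<close>

lemma common_point_outside_small_sets:
  assumes "finite_measure M" "finite S" "real (card S) \<le> n" "0 < n" "0 < measure M (space M)"
    and H: "\<And>v. v \<in> S \<Longrightarrow> H v \<in> sets M" "\<And>v. v \<in> S \<Longrightarrow> measure M (H v) < measure M (space M) / n"
    and N: "N \<in> null_sets M"
  shows "\<exists>z\<in>space M - N. \<forall>v\<in>S. z \<notin> H v"
proof (rule ccontr)
  interpret finite_measure M by fact
  assume "\<not> ?thesis"
  then have "space M \<subseteq> (\<Union>v\<in>S. H v) \<union> N" by blast
  then have "measure M (space M) \<le> measure M ((\<Union>v\<in>S. H v) \<union> N)"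
    using H N assms(2) by (intro finite_measure_mono sets.Un sets.finite_UN) auto
  also have "\<dots> = measure M (\<Union>v\<in>S. H v)"
    using H N assms(2) by (intro measure_Un_null_set) auto
  also have "\<dots> \<le> (\<Sum>v\<in>S. measure M (H v))"
    using H assms(2) by (intro finite_measure_subadditive_finite) auto
  finally have le: "measure M (space M) \<le> (\<Sum>v\<in>S. measure M (H v))" .
  then have "S \<noteq> {}" using assms by auto
  then have "(\<Sum>v\<in>S. measure M (H v)) < (\<Sum>v\<in>S. measure M (space M) / n)"
    using H assms(2) by (intro sum_strict_mono) auto
  also have "\<dots> = real (card S) * measure M (space M) / n" by simp
  also have "\<dots> \<le> measure M (space M)"
    using assms by (simp add: divide_le_eq mult.commute mult_left_mono)
  finally show False using le by simp
qed

text \<open>Divide by the total weight. Restricting the hull to positive weights matters later: the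
  directions with positive weight at \<open>c\<close> are those that are bad at
  \<open>c\<close>.\<close>

lemma nonneg_combination_in_convex_hull:
  fixes V :: "'a::real_vector set"
  assumes "finite V" "\<And>v. v \<in> V \<Longrightarrow> 0 \<le> a v" "\<exists>v\<in>V. 0 < a v"
  shows "\<exists>s>0. \<exists>x\<in>convex hull {v\<in>V. 0 < a v}. (\<Sum>v\<in>V. a v *\<^sub>R v) = s *\<^sub>R x"
proof -
  let ?P = "{v\<in>V. 0 < a v}"
  define s where "s = sum a ?P"
  have s: "s > 0" unfolding s_def using assms by (intro sum_pos) auto
  have "(\<Sum>v\<in>V. a v *\<^sub>R v) = (\<Sum>v\<in>?P. a v *\<^sub>R v)"
    using assms by (intro sum.mono_neutral_right) (auto simp: less_eq_real_def)
  also have "\<dots> = s *\<^sub>R (\<Sum>v\<in>?P. (a v / s) *\<^sub>R v)"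
    using s by (simp add: scaleR_sum_right)
  finally have "(\<Sum>v\<in>V. a v *\<^sub>R v) = s *\<^sub>R (\<Sum>v\<in>?P. (a v / s) *\<^sub>R v)" .
  moreover have "(\<Sum>v\<in>?P. (a v / s) *\<^sub>R v) \<in> convex hull ?P"
    using assms s
    by (intro convex_sum convex_convex_hull)
       (auto simp: s_def hull_inc simp flip: sum_divide_distrib)
  ultimately show ?thesis using s by blast
qed

text \<open>Brouwer gives a fixed point \<open>c\<close> of the projection of \<open>c + W c\<close>
  to the ball. There \<open>W c\<close> lies in the normal cone of the ball, which is trivial in the
  interior and an outward ray on the boundary.\<close>

lemma continuous_field_vanishes_or_points_outwards:
  fixes W :: "'a::euclidean_space \<Rightarrow> 'a"
  assumes W: "continuous_on (cball 0 R) W" and "0 < R"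
  shows "\<exists>c\<in>cball 0 R. W c = 0 \<or> (norm c = R \<and> (\<exists>s>0. W c = s *\<^sub>R c))"
proof -
  let ?K = "cball (0::'a) R"
  define g where "g c = closest_point ?K (c + W c)" for c
  have "continuous_on ?K g"
    unfolding g_def using \<open>0 < R\<close>
    by (intro continuous_on_compose2[OF continuous_on_closest_point[of ?K UNIV]]
        continuous_intros W) auto
  moreover have "g ` ?K \<subseteq> ?K"
    unfolding g_def using \<open>0 < R\<close> by (auto intro!: closest_point_in_set simp del: mem_cball)
  ultimately obtain c where c: "c \<in> ?K" "g c = c"
    using brouwer_ball[OF \<open>0 < R\<close>, of 0 g] by (auto simp: image_subset_iff_funcset)
  have var: "W c \<bullet> (x - c) \<le> 0" if "x \<in> ?K" for x
    using closest_point_dot[of ?K x "c + W c"] c that by (simp add: g_def)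
  show ?thesis
  proof (cases "W c = 0")
    case False
    then have nW: "norm (W c) > 0" by simp
    \<comment> \<open>Testing with the boundary point in direction \<open>W c\<close> forces
      equality in the Cauchy-Schwarz inequality.\<close>
    have "W c \<bullet> ((R / norm (W c)) *\<^sub>R W c - c) \<le> 0"
      using \<open>0 < R\<close> nW by (intro var) simp
    then have 1: "R * norm (W c) \<le> W c \<bullet> c"
      using nW by (simp add: inner_diff_right dot_square_norm power2_eq_square)
    have 2: "W c \<bullet> c \<le> norm (W c) * norm c" by (rule norm_cauchy_schwarz)
    have 3: "norm c \<le> R" using c by simp
    have "R * norm (W c) \<le> norm c * norm (W c)" using 1 2 by (simp add: mult.commute)
    then have R: "norm c = R" using nW 3 by simp
    then have "W c \<bullet> c = norm (W c) * norm c" using 1 2 by (simp add: mult.commute)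
    then have "norm (W c) *\<^sub>R c = R *\<^sub>R W c"
      using norm_cauchy_schwarz_eq[of "W c" c] R by simp
    then have "(1 / R) *\<^sub>R norm (W c) *\<^sub>R c = (1 / R) *\<^sub>R R *\<^sub>R W c"
      by simp
    then have "W c = (norm (W c) / R) *\<^sub>R c"
      using \<open>0 < R\<close> by simp
    moreover have "norm (W c) / R > 0" using nW \<open>0 < R\<close> by simp
    ultimately show ?thesis using c R by blast
  qed (use c in blast)
qed

section \<open>Existence of a centre point for a convex coercive function\<close>

theorem convex_centerpoint:
  fixes f :: "'a::euclidean_space \<Rightarrow> real"
  assumes M: "finite_measure M" and sets: "sets M = sets borel"
    and supp: "bounded (measure_support M)"
    and f: "convex_on UNIV f" and coercive: "\<And>B. \<exists>R. \<forall>y. R \<le> norm y \<longrightarrow> B \<le> f y"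
  shows "\<exists>c. \<forall>v. measure M UNIV / (DIM('a) + 1) \<le> measure M (convex_halfspace f c v)"
proof (rule ccontr)
  interpret finite_measure M by fact
  let ?\<tau> = "measure M UNIV / (DIM('a) + 1)"
  assume "\<not> ?thesis"
  then have bad: "\<exists>v. measure M (convex_halfspace f c v) < ?\<tau>" for c
    by (auto simp: not_le)
  have contf: "continuous_on UNIV f"
    using f convex_on_continuous by blast
  have sp: "space M = UNIV" using sets_eq_imp_space_eq[OF sets] by simp
  \<comment> \<open>A nonnegative mass lies strictly below the threshold, so the total mass is
    positive.\<close>
  have "0 < ?\<tau>" using bad measure_nonneg le_less_trans by blast
  then have pos: "0 < measure M UNIV" by (simp add: zero_less_divide_iff)
  obtain r where r: "r > 0" "measure_support M \<subseteq> cball 0 r"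
    using bounded_subset_ballD[OF supp, of 0] ball_subset_cball by blast
  have "compact (f ` cball 0 r)"
    using contf by (intro compact_continuous_image) (auto intro: continuous_on_subset)
  then obtain B where B: "\<And>z. z \<in> cball 0 r \<Longrightarrow> f z \<le> B"
    using compact_imp_bounded bounded_has_Sup(1) by (metis empty_iff imageI)
  obtain R0 where R0: "\<And>y. R0 \<le> norm y \<Longrightarrow> B \<le> f y" using coercive by blast
  \<comment> \<open>For \<open>norm c = R\<close> and \<open>norm z \<le> r\<close> this gives
    \<open>R0 \<le> norm (c - z)\<close>, hence \<open>B \<le> f (c - z)\<close>.\<close>
  define R where "R = max R0 0 + r"
  have "R > 0" using r by (simp add: R_def)
  let ?K = "cball (0::'a) R"
  \<comment> \<open>The ball contains \<open>?K\<close> and keeps the complement of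
    \<open>U v\<close> nonempty; \<open>infdist\<close> to the empty set would be 0 by convention,
    and the weight below would vanish.\<close>
  define U where "U v = {c. measure M (convex_halfspace f c v) < ?\<tau>} \<inter> ball 0 (R + 1)" for v
  have U: "open (U v)" for v
    unfolding U_def by (intro open_Int open_convex_halfspace_measure_less M sets contf open_ball)
  have "?K \<subseteq> (\<Union>v\<in>UNIV. U v)"
    using bad by (fastforce simp: U_def)
  then obtain V where V: "finite V" "?K \<subseteq> (\<Union>v\<in>V. U v)"
    using compactE_image[of ?K UNIV U] U compact_cball by metis
  \<comment> \<open>These continuous weights, positive exactly on \<open>U v\<close>, form the
    partition of unity up to normalisation, which would only rescale \<open>W c\<close> by a
    positive factor.\<close>
  define a where "a v c = infdist c (- U v)" for v c
  have "\<not> U v = UNIV" for v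
    using not_bounded_UNIV bounded_subset[OF bounded_ball, of "U v" 0 "R + 1"] by (metis U_def inf_le2)
  then have a_pos: "0 < a v c \<longleftrightarrow> c \<in> U v" for v c
    using in_closed_iff_infdist_zero[of "- U v" c] U[of v] infdist_nonneg[of c "- U v"]
    by (auto simp: a_def less_le)
  define W where "W c = (\<Sum>v\<in>V. a v c *\<^sub>R v)" for c
  have W: "\<exists>z\<in>cball 0 r. W c \<in> descent_directions f (c - z)" if "c \<in> ?K" for c
  proof -
    have "\<exists>v\<in>V. 0 < a v c" using V that a_pos by auto
    then obtain s x where sx: "s > 0" "x \<in> convex hull {v\<in>V. 0 < a v c}" "W c = s *\<^sub>R x"
      using nonneg_combination_in_convex_hull[OF V(1), of "\<lambda>v. a v c"]
      by (auto simp: a_def W_def infdist_nonneg)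
    \<comment> \<open>The Caratheodory bound \<open>DIM('a) + 1\<close> is the denominator of the
      threshold, so the halfspaces of \<open>S\<close> leave a point of the support
      uncovered.\<close>
    then obtain S where S: "finite S" "S \<subseteq> {v\<in>V. 0 < a v c}" "card S \<le> DIM('a) + 1" "x \<in> convex hull S"
      unfolding caratheodory[of "{v\<in>V. 0 < a v c}"] by blast
    have "\<exists>z\<in>space M - (- measure_support M). \<forall>v\<in>S. z \<notin> convex_halfspace f c v"
    proof (rule common_point_outside_small_sets[where n = "DIM('a) + 1"])
      show "measure M (convex_halfspace f c v) < measure M (space M) / (DIM('a) + 1)" if "v \<in> S" for v
        using that S a_pos[of v c] by (auto simp: U_def sp)
    qed (use S M Compl_measure_support_null_set[OF sets] pos sp sets closed_convex_halfspace[OF contf] in auto)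
    then obtain z where z: "z \<in> measure_support M" "S \<subseteq> descent_directions f (c - z)"
      by (auto simp: notin_convex_halfspace)
    then have "x \<in> descent_directions f (c - z)"
      using S(4) hull_minimal[OF z(2), of convex] convex_descent_directions[OF f] by blast
    then have "W c \<in> descent_directions f (c - z)"
      using sx descent_directions_scaleR by metis
    then show ?thesis using z(1) r by blast
  qed
  \<comment> \<open>The sign turns \<open>W c\<close> into the displacement along which
    \<open>f\<close> decreases.\<close>
  have "continuous_on ?K (\<lambda>c. - W c)"
    unfolding W_def a_def by (intro continuous_intros)
  then obtain c where c: "c \<in> ?K"
      "- W c = 0 \<or> (norm c = R \<and> (\<exists>s>0. - W c = s *\<^sub>R c))"
    using continuous_field_vanishes_or_points_outwards[of R "\<lambda>c. - W c"] \<open>0 < R\<close> by blast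
  obtain z where z: "z \<in> cball 0 r" "W c \<in> descent_directions f (c - z)"
    using W[OF c(1)] by blast
  with c(2) zero_notin_descent_directions[of f] obtain s
    where s: "norm c = R" "s > 0" "- W c = s *\<^sub>R c" by auto
  then have "f (c - z) < f (- z)"
    using z by (intro descent_directions_radial[OF f, of s]) (auto simp flip: s(3))
  \<comment> \<open>The point \<open>- z\<close> lies in the small ball, where \<open>f\<close> is
    at most \<open>B\<close>, while \<open>c - z\<close> is far enough out for \<open>f\<close> to
    be at least \<open>B\<close>.\<close>
  moreover have "f (- z) \<le> B" using z by (intro B) simp
  moreover have "B \<le> f (c - z)"
    using z s(1) norm_triangle_ineq2[of c z] by (intro R0) (simp add: R_def)
  ultimately show False by simp
qed

section \<open>The p-norms\<close>

lemma convex_on_abs_powr: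
  assumes "1 \<le> p"
  shows "convex_on UNIV (\<lambda>x::real. \<bar>x\<bar> powr p)"
proof (rule convex_onI)
  fix t x y :: real
  assume t: "0 < t" "t < 1"
  \<comment> \<open>This settles the case of a zero argument; \<open>powr_convex\<close> is applied
    to positive arguments.\<close>
  have scale: "(s * u) powr p \<le> s * u powr p" if "0 < s" "s < 1" "0 \<le> u" for s u :: real
    using that assms powr_mono'[of 1 p s] by (simp add: powr_mult mult_right_mono)
  have nonneg: "((1 - t) * u + t * w) powr p \<le> (1 - t) * u powr p + t * w powr p"
    if "0 \<le> u" "0 \<le> w" for u w
  proof (cases "u = 0 \<or> w = 0")
    case True
    then show ?thesis
      using scale[of t w] scale[of "1 - t" u] t that assms by auto
  next
    case False
    then show ?thesis
      using convex_onD[OF powr_convex[OF assms], of t u w] t that by simp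
  qed
  have "\<bar>(1 - t) *\<^sub>R x + t *\<^sub>R y\<bar> \<le> (1 - t) * \<bar>x\<bar> + t * \<bar>y\<bar>"
    using t abs_triangle_ineq[of "(1 - t) * x" "t * y"] by (simp add: abs_mult)
  then have "\<bar>(1 - t) *\<^sub>R x + t *\<^sub>R y\<bar> powr p \<le> ((1 - t) * \<bar>x\<bar> + t * \<bar>y\<bar>) powr p"
    using assms by (intro powr_mono2) auto
  also have "\<dots> \<le> (1 - t) * \<bar>x\<bar> powr p + t * \<bar>y\<bar> powr p" by (intro nonneg) auto
  finally show "\<bar>(1 - t) *\<^sub>R x + t *\<^sub>R y\<bar> powr p \<le> (1 - t) * \<bar>x\<bar> powr p + t * \<bar>y\<bar> powr p" .
qed simp

lemma convex_on_sum_abs_powr: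
  assumes "1 \<le> p"
  shows "convex_on UNIV (\<lambda>x::real^'n. \<Sum>i\<in>UNIV. \<bar>x $ i\<bar> powr p)"
proof (rule convex_onI)
  fix t and x y :: "real^'n"
  assume t: "0 < t" "t < (1::real)"
  have "(\<Sum>i\<in>UNIV. \<bar>((1 - t) *\<^sub>R x + t *\<^sub>R y) $ i\<bar> powr p)
      \<le> (\<Sum>i\<in>UNIV. (1 - t) * \<bar>x $ i\<bar> powr p + t * \<bar>y $ i\<bar> powr p)"
    using convex_onD[OF convex_on_abs_powr[OF assms], of t] t by (intro sum_mono) auto
  then show "(\<Sum>i\<in>UNIV. \<bar>((1 - t) *\<^sub>R x + t *\<^sub>R y) $ i\<bar> powr p)
      \<le> (1 - t) * (\<Sum>i\<in>UNIV. \<bar>x $ i\<bar> powr p) + t * (\<Sum>i\<in>UNIV. \<bar>y $ i\<bar> powr p)"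
    by (simp add: sum.distrib sum_distrib_left)
qed simp

text \<open>Coercivity of the power sum: each coordinate satisfies
  \<open>t \<le> 1 + t powr p\<close>, and the l1-norm dominates the Euclidean norm.\<close>

lemma norm_le_sum_abs_powr:
  fixes x :: "real^'n"
  assumes "1 \<le> p"
  shows "norm x \<le> CARD('n) + (\<Sum>i\<in>UNIV. \<bar>x $ i\<bar> powr p)"
proof -
  have "t \<le> 1 + t powr p" if "0 \<le> t" for t :: real
  proof (cases "t \<le> 1")
    case True
    then show ?thesis using powr_ge_zero[of t p] by linarith
  next
    case False
    then show ?thesis using powr_mono[of 1 p t] assms by simp
  qed
  then have "(\<Sum>i\<in>UNIV. \<bar>x $ i\<bar>) \<le> (\<Sum>i\<in>UNIV. 1 + \<bar>x $ i\<bar> powr p)"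
    by (intro sum_mono) auto
  then show ?thesis
    using norm_le_l1_cart[of x] by (simp add: sum.distrib)
qed

lemma convex_on_infnorm: "convex_on UNIV (infnorm :: 'a::euclidean_space \<Rightarrow> real)"
proof (rule convex_onI)
  fix t and x y :: 'a
  assume "0 < t" "t < (1::real)"
  then show "infnorm ((1 - t) *\<^sub>R x + t *\<^sub>R y) \<le> (1 - t) * infnorm x + t * infnorm y"
    using infnorm_triangle[of "(1 - t) *\<^sub>R x" "t *\<^sub>R y"] by (simp add: infnorm_mul)
qed simp

text \<open>A halfspace depends only on comparisons between values, so the norm may be replaced by
  an increasing function of it. For finite \<open>p\<close> the p-th power makes convexity a matter
  of single coordinates.\<close>

lemma lp_halfspace_eq_convex_halfspace:
  assumes "1 \<le> p"
  obtains f :: "real^'n \<Rightarrow> real" where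
    "convex_on UNIV f" "\<And>B. \<exists>R. \<forall>y. R \<le> norm y \<longrightarrow> B \<le> f y" "lp_halfspace p = convex_halfspace f"
proof (cases "p = \<infinity>")
  case True
  have "\<exists>R. \<forall>y::real^'n. R \<le> norm y \<longrightarrow> B \<le> infnorm y" for B
  proof (intro exI allI impI)
    fix y :: "real^'n"
    assume "sqrt (DIM(real^'n)) * B \<le> norm y"
    also have "\<dots> \<le> sqrt (DIM(real^'n)) * infnorm y" by (rule norm_le_infnorm)
    finally show "B \<le> infnorm y" by simp
  qed
  then show ?thesis
    using True by (intro that[OF convex_on_infnorm])
      (auto simp: fun_eq_iff lp_halfspace_def convex_halfspace_def lp_norm_def)
next
  case False
  then obtain q where q: "p = ereal q" "1 \<le> q"
    using assms by (cases p) auto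
  let ?f = "\<lambda>x::real^'n. \<Sum>i\<in>UNIV. \<bar>x $ i\<bar> powr q"
  have "\<exists>R. \<forall>y. R \<le> norm y \<longrightarrow> B \<le> ?f y" for B
  proof (intro exI allI impI)
    fix y :: "real^'n"
    assume "CARD('n) + B \<le> norm y"
    then show "B \<le> ?f y" using norm_le_sum_abs_powr[OF q(2), of y] by simp
  qed
  moreover have "lp_norm p x \<le> lp_norm p y \<longleftrightarrow> ?f x \<le> ?f y" for x y :: "real^'n"
  proof -
    \<comment> \<open>The root \<open>powr (1/q)\<close> is strictly increasing on nonnegative
      reals, so it preserves and reflects the order.\<close>
    have "0 \<le> ?f x" "0 \<le> ?f y" by (auto intro: sum_nonneg)
    then show ?thesis
      using q powr_mono2[of "1/q" "?f x" "?f y"] powr_less_mono2[of "1/q" "?f y" "?f x"]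
      by (fastforce simp: lp_norm_def)
  qed
  ultimately show ?thesis
    by (intro that[OF convex_on_sum_abs_powr[OF q(2)]])
       (auto simp: fun_eq_iff lp_halfspace_def convex_halfspace_def)
qed

theorem theorem3p13:
  fixes \<mu> :: "(real ^ 'n) measure" and p :: ereal
  assumes "mass_distribution \<mu>"
    and "bounded (measure_support \<mu>)"
    and "1 \<le> p"
  shows "\<exists>c :: real ^ 'n. \<forall>v \<in> sphere 0 1.
           measure \<mu> (lp_halfspace p c v) \<ge> 1 / (real CARD('n) + 1) * measure \<mu> UNIV"
proof -
  have sets: "sets \<mu> = sets borel"
    using assms(1) by (simp add: mass_distribution_def)
  have "space \<mu> = UNIV" using sets_eq_imp_space_eq[OF sets] by simp
  then have fin: "finite_measure \<mu>"
    using assms(1) by (intro finite_measureI) (auto simp: mass_distribution_def)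
  obtain f :: "real^'n \<Rightarrow> real" where f: "convex_on UNIV f"
      "\<And>B. \<exists>R. \<forall>y. R \<le> norm y \<longrightarrow> B \<le> f y" "lp_halfspace p = convex_halfspace f"
    using lp_halfspace_eq_convex_halfspace[OF assms(3)] by metis
  show ?thesis
    using convex_centerpoint[OF fin sets assms(2) f(1,2)] by (auto simp: f(3) add.commute)
qed

end
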